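(* Let $n,k,i$ be integers with $1\leq k\leq n-1$ and $0\leq i\leq n-1$. Let $d'(n,k,i)$ be the smallest dimension $d$ for which there is a linear map $\pi:\mathbb{R}^n\to\mathbb{R}^d$ such that the projection $\Delta_{n,k}\to\pi(\Delta_{n,k})$ strictly preserves every face of the $i$-dimensional skeleton of the hypersimplex $\Delta_{n,k}$ and such that the associated point configuration $S_\pi=\{\pi(\mathbf e_j): 1\leq j\leq n\}$ is in convex position. Then $$d'(n,k,i)=\begin{cases}2k+2i &\text{if } n\geq 2k+2i+2,\\ 2n-2k+2i &\text{if } n\leq 2k-2i-2,\\ n-1 &\text{if } 2k-2i-1\leq n\leq 2k+2i+1 \text{ and } k\in C_{n,i},\\ n-2 &\text{if } 2k-2i-1\leq n\leq 2k+2i+1 \text{ and } k\notin C_{n,i},\end{cases}$$ where $C_{n,i}=\{1,2,\ldots,i+2\}\cup\{n-i-2,n-i-1,\ldots,n-1\}$.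
   Context: The $(n,k)$-hypersimplex is $\Delta_{n,k}=\operatorname{conv}\{x\in\{0,1\}^n : \sum_{j=1}^n x_j=k\}\subset\mathbb{R}^n$, and $\mathbf e_1,\dots,\mathbf e_n$ is the standard basis of $\mathbb{R}^n$. For a polytope $P$ and an affine map $\pi:P\to\pi(P)$, a face $F\subseteq P$ is strictly preserved under $\pi$ if (i) $\pi(F)$ is a face of $\pi(P)$, (ii) $\pi^{-1}(\pi(F))=F$, and (iii) the map $F\to\pi(F)$ is a bijection. Faces include the polytope itself. The $i$-dimensional skeleton consists of all faces of dimension at most $i$. The points $\pi(\mathbf e_1),\dots,\pi(\mathbf e_n)$ are in convex position if they are pairwise distinct and none of them is a convex combination of the others. *)

theory Defs
  imports "HOL-Analysis.Analysis" "HOL-Analysis.Finite_Function_Topology"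
begin

definition hypersimplex :: "nat \<Rightarrow> (real^'n) set" where
  "hypersimplex k =
     convex hull {x. (\<forall>j. x $ j \<in> {0, 1}) \<and> (\<Sum>j\<in>UNIV. x $ j) = real k}"

definition skeleton :: "nat \<Rightarrow> 'a::euclidean_space set \<Rightarrow> 'a set set" where
  "skeleton i P = {F. F face_of P \<and> aff_dim F \<le> int i}"

definition strictly_preserved ::
    "('a::real_vector \<Rightarrow> 'b::real_vector) \<Rightarrow> 'a set \<Rightarrow> 'a set \<Rightarrow> bool" where
  "strictly_preserved \<pi> P F \<longleftrightarrow>
     (\<pi> ` F) face_of (\<pi> ` P) \<and>
     {x \<in> P. \<pi> x \<in> \<pi> ` F} = F \<and>
     bij_betw \<pi> F (\<pi> ` F)"

definition convex_position :: "('i \<Rightarrow> 'a::real_vector) \<Rightarrow> bool" where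
  "convex_position p \<longleftrightarrow> inj p \<and> (\<forall>j. p j \<notin> convex hull (p ` (UNIV - {j})))"

text \<open>
  The target dimension \<open>d\<close> is a bound variable below, so it cannot be the
  cardinality of an index type.  We therefore realise \<open>\<real>\<^sup>d\<close> as the space of
  finitely supported real sequences whose support is contained in \<open>{..<d}\<close>.
\<close>

definition coord_space :: "nat \<Rightarrow> (nat \<Rightarrow>\<^sub>0 real) set" where
  "coord_space d = {y. Poly_Mapping.keys y \<subseteq> {..<d}}"

definition good_projection ::
    "nat \<Rightarrow> nat \<Rightarrow> nat \<Rightarrow> (real^'n \<Rightarrow> (nat \<Rightarrow>\<^sub>0 real)) \<Rightarrow> bool" where
  "good_projection k i d \<pi> \<longleftrightarrow>
     linear \<pi> \<and> range \<pi> \<subseteq> coord_space d \<and>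
     (\<forall>F \<in> skeleton i (hypersimplex k). strictly_preserved \<pi> (hypersimplex k) F) \<and>
     convex_position (\<lambda>j. \<pi> (axis j 1))"

text \<open>The type argument fixes the ambient space; \<open>n\<close> is \<open>CARD('n)\<close>.\<close>

definition min_proj_dim :: "'n::finite itself \<Rightarrow> nat \<Rightarrow> nat \<Rightarrow> nat" where
  "min_proj_dim _ k i =
     (LEAST d. \<exists>\<pi> :: real^'n \<Rightarrow> (nat \<Rightarrow>\<^sub>0 real). good_projection k i d \<pi>)"

definition C_set :: "int \<Rightarrow> int \<Rightarrow> int set" where
  "C_set n i = {1..i + 2} \<union> {n - i - 2..n - 1}"

lemma lookup_scaleR_poly_mapping:
  "Poly_Mapping.lookup (r *\<^sub>R y) i = r *\<^sub>R Poly_Mapping.lookup (y :: 'b \<Rightarrow>\<^sub>0 'a::real_vector) i"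
proof -
  have "finite {i. r *\<^sub>R Poly_Mapping.lookup y i \<noteq> 0}"
    by (rule finite_subset[of _ "Poly_Mapping.keys y"]) (auto simp: in_keys_iff)
  then show ?thesis
    by (simp add: scaleR_poly_mapping_def Abs_poly_mapping_inverse)
qed

text \<open>
  The minimum defining \<open>min_proj_dim\<close> is attained: an isomorphism onto
  \<open>coord_space CARD('n)\<close> is a good projection.
\<close>

lemma good_projection_exists:
  "\<exists>\<pi> :: real^'n \<Rightarrow> (nat \<Rightarrow>\<^sub>0 real). good_projection k i CARD('n) \<pi>"
proof -
  obtain f :: "'n \<Rightarrow> nat" where f: "bij_betw f UNIV {..<CARD('n)}"
    using ex_bij_betw_finite_nat[of "UNIV :: 'n set"] by (auto simp: atLeast0LessThan)
  define \<pi> :: "real^'n \<Rightarrow> (nat \<Rightarrow>\<^sub>0 real)"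
    where "\<pi> x = (\<Sum>j\<in>UNIV. (x $ j) *\<^sub>R Poly_Mapping.single (f j) 1)" for x
  have lin: "linear \<pi>"
    unfolding \<pi>_def
    by (rule linearI) (simp_all add: scaleR_add_left sum.distrib scaleR_sum_right)
  have lk: "Poly_Mapping.lookup (\<pi> x) m = (\<Sum>j\<in>UNIV. x $ j * (1 when f j = m))" for x m
    unfolding \<pi>_def
    by (simp add: lookup_sum lookup_scaleR_poly_mapping lookup_single)
  have lkf: "Poly_Mapping.lookup (\<pi> x) (f l) = x $ l" for x l
  proof -
    have "(1 when f j = f l) = (if j = l then 1 else (0::real))" for j
      using f by (auto simp: bij_betw_def inj_def when_def)
    then show ?thesis
      by (simp add: lk if_distrib[of "(*) _"] cong: if_cong)
  qed
  have inj: "inj \<pi>"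
    by (rule injI) (metis lkf vec_eq_iff)
  have "Poly_Mapping.lookup (\<pi> x) m = 0" if "\<not> m < CARD('n)" for x m
  proof -
    have "f j \<noteq> m" for j
      using f that by (auto simp: bij_betw_def)
    then show ?thesis by (simp add: lk)
  qed
  then have range: "range \<pi> \<subseteq> coord_space CARD('n)"
    by (auto simp: coord_space_def in_keys_iff)
  have pres: "strictly_preserved \<pi> P F" if "F face_of P" for P F
  proof -
    have "{x \<in> P. \<pi> x \<in> \<pi> ` F} = F"
      using face_of_imp_subset[OF that] by (auto simp: inj_image_mem_iff[OF inj])
    moreover have "(\<pi> ` F) face_of (\<pi> ` P)"
      using face_of_linear_image[OF lin inj] that by blast
    moreover have "bij_betw \<pi> F (\<pi> ` F)"
      using inj by (meson inj_on_imp_bij_betw inj_on_subset subset_UNIV)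
    ultimately show ?thesis by (simp add: strictly_preserved_def)
  qed
  have "axis j 1 \<notin> convex hull ((\<lambda>l. axis l (1::real)) ` (UNIV - {j}))" for j :: 'n
  proof
    assume "axis j 1 \<in> convex hull ((\<lambda>l. axis l (1::real)) ` (UNIV - {j}))"
    moreover have "convex hull ((\<lambda>l. axis l (1::real)) ` (UNIV - {j})) \<subseteq> {x. axis j 1 \<bullet> x = 0}"
      by (rule hull_minimal) (auto simp: inner_axis_axis convex_hyperplane)
    ultimately show False by (auto simp: inner_axis_axis)
  qed
  moreover have "convex hull ((\<lambda>l. \<pi> (axis l 1)) ` (UNIV - {j})) =
      \<pi> ` (convex hull ((\<lambda>l. axis l 1) ` (UNIV - {j})))" for j
    by (simp only: convex_hull_linear_image[OF lin] image_image)
  moreover have "inj (\<lambda>j. \<pi> (axis j 1))"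
    using inj by (auto intro!: injI dest!: injD simp: axis_eq_axis)
  ultimately have "convex_position (\<lambda>j. \<pi> (axis j 1))"
    by (simp add: convex_position_def inj_image_mem_iff[OF inj])
  with lin range pres show ?thesis
    by (auto simp: good_projection_def skeleton_def)
qed

end

theory Submission
  imports Defs
begin

text \<open>
  Everything is read off the space \<open>K\<close> of linear dependencies \<open>v\<close> among the points
  \<open>\<pi>(e\<^sub>j)\<close> with \<open>\<Sum>\<^sub>j v\<^sub>j = 0\<close>, that is, the kernel of \<open>\<pi>\<close> on the directions of
  the hypersimplex; for generic \<open>\<pi>\<close> its dimension is \<open>n - d - 1\<close>.  Write \<open>N\<close> and \<open>P\<close> for
  the numbers of negative and positive entries of \<open>v\<close>.  The \<open>i\<close>-skeleton is strictly preserved iff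
  every nonzero \<open>v \<in> K\<close> has \<open>N > k + i\<close> or \<open>P > n - k + i\<close>, and the configuration is in
  convex position iff \<open>N \<ge> 2\<close> for all such \<open>v\<close>.

  Put \<open>m = min k (n - k)\<close>.  Since \<open>K = - K\<close>, every nonzero \<open>v\<close> is balanced
  (\<open>N, P > m + i\<close>) or has \<open>N > n - m + i\<close> or \<open>P > n - m + i\<close>; these three conditions are open
  and mutually exclusive.  If \<open>dim K \<ge> 2\<close>, then \<open>K - {0}\<close> is connected, so all of its
  elements are balanced, and an element of small support gives \<open>dim K \<le> n - 1 - 2m - 2i\<close>.
  The cyclic configuration on the moment curve attains this bound.  If \<open>dim K = 1\<close>, an unbalanced
  \<open>v\<close> is allowed exactly if \<open>n - m + i + 1 \<le> n - 2\<close>, and two negative entries against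
  \<open>n - 2\<close> positive ones realise it.
\<close>

section \<open>Faces of the hypersimplex in coordinates\<close>

text \<open>Inequality description of the hypersimplex, in which it can be tested coordinatewise how
  far a point may move.\<close>

definition cube_slice :: "nat \<Rightarrow> (real^'n) set" where
  "cube_slice k = {x. (\<forall>j. 0 \<le> x $ j \<and> x $ j \<le> 1) \<and> (\<Sum>j\<in>UNIV. x $ j) = real k}"

definition fractional :: "real^'n \<Rightarrow> 'n set" where
  "fractional x = {j. 0 < x $ j \<and> x $ j < 1}"

text \<open>For \<open>M = fractional x\<close> this is the direction space of the smallest face
  through \<open>x\<close>.\<close>

definition zero_sum_on :: "'n set \<Rightarrow> (real^'n) set" where
  "zero_sum_on M = {v. (\<forall>j. j \<notin> M \<longrightarrow> v $ j = 0) \<and> (\<Sum>j\<in>UNIV. v $ j) = 0}"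

lemma ones_fractional_sum:
  assumes "x \<in> cube_slice k"
  shows "real k = real (card {j. x $ j = 1}) + (\<Sum>j\<in>fractional x. x $ j)"
proof -
  have "real k = (\<Sum>j\<in>UNIV. x $ j)"
    using assms by (simp add: cube_slice_def)
  also have "\<dots> = (\<Sum>j\<in>{j. x $ j = 1} \<union> fractional x. x $ j)"
  proof (rule sum.mono_neutral_right)
    show "\<forall>j\<in>UNIV - ({j. x $ j = 1} \<union> fractional x). x $ j = 0"
      using assms by (force simp: fractional_def cube_slice_def order_less_le)
  qed auto
  also have "\<dots> = (\<Sum>j\<in>{j. x $ j = 1}. x $ j) + (\<Sum>j\<in>fractional x. x $ j)"
    by (rule sum.union_disjoint) (auto simp: fractional_def)
  finally show ?thesis by simp
qed

text \<open>The fractional entries contribute to the sum \<open>k\<close> an amount strictly between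
  0 and their number.\<close>

lemma card_ones_fractional:
  assumes x: "x \<in> cube_slice k" and ne: "fractional x \<noteq> {}"
  shows "card {j. x $ j = 1} < k" "k < card {j. x $ j = 1} + card (fractional x)"
proof -
  have "0 < (\<Sum>j\<in>fractional x. x $ j)"
    by (rule sum_pos) (use ne in \<open>auto simp: fractional_def\<close>)
  with ones_fractional_sum[OF x] show "card {j. x $ j = 1} < k" by linarith
  have "(\<Sum>j\<in>fractional x. x $ j) < (\<Sum>j\<in>fractional x. 1)"
    by (rule sum_strict_mono) (use ne in \<open>auto simp: fractional_def\<close>)
  with ones_fractional_sum[OF x] show "k < card {j. x $ j = 1} + card (fractional x)"
    by simp
qed

text \<open>A negative entry of \<open>v\<close> threatens only the bound 0, a positive one only the
  bound 1. The eventual form lets \<open>v\<close> and \<open>- v\<close> share one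
  \<open>e\<close>.\<close>

lemma eventually_feasible:
  assumes x: "x \<in> cube_slice k" and sum0: "(\<Sum>j\<in>UNIV. v $ j) = 0"
    and neg: "\<And>j. v $ j < 0 \<Longrightarrow> 0 < x $ j" and pos: "\<And>j. 0 < v $ j \<Longrightarrow> x $ j < 1"
  shows "\<forall>\<^sub>F e in at_right 0. x + e *\<^sub>R v \<in> cube_slice k"
proof -
  have bd: "0 \<le> x $ j" "x $ j \<le> 1" for j
    using x by (auto simp: cube_slice_def)
  have "\<forall>\<^sub>F e in at_right 0. 0 \<le> x $ j + e * v $ j \<and> x $ j + e * v $ j \<le> 1" for j
  proof -
    consider "v $ j < 0" | "v $ j = 0" | "0 < v $ j" by linarith
    then show ?thesis
    proof cases
      case 1
      then have "0 < x $ j / (- v $ j)" using neg by (intro divide_pos_pos) auto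
      from eventually_at_right_real[OF this] show ?thesis
      proof (rule eventually_mono)
        fix e assume "e \<in> {0<..<x $ j / (- v $ j)}"
        then have "e > 0" "e * (- v $ j) < x $ j"
          using 1 by (auto simp: field_simps)
        moreover have "e * v $ j < 0" using 1 \<open>e > 0\<close> by (simp add: mult_pos_neg)
        ultimately show "0 \<le> x $ j + e * v $ j \<and> x $ j + e * v $ j \<le> 1"
          using bd[of j] by auto
      qed
    next
      case 2
      then show ?thesis using bd[of j] by simp
    next
      case 3
      then have "0 < (1 - x $ j) / v $ j" using pos by (intro divide_pos_pos) auto
      from eventually_at_right_real[OF this] show ?thesis
      proof (rule eventually_mono)
        fix e assume "e \<in> {0<..<(1 - x $ j) / v $ j}"
        then have "e > 0" "e * v $ j < 1 - x $ j"
          using 3 by (auto simp: field_simps)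
        moreover have "e * v $ j > 0" using 3 \<open>e > 0\<close> by simp
        ultimately show "0 \<le> x $ j + e * v $ j \<and> x $ j + e * v $ j \<le> 1"
          using bd[of j] by auto
      qed
    qed
  qed
  then have "\<forall>\<^sub>F e in at_right 0. \<forall>j. 0 \<le> x $ j + e * v $ j \<and> x $ j + e * v $ j \<le> 1"
    by (rule eventually_all_finite)
  then show ?thesis
  proof (rule eventually_mono)
    fix e assume "\<forall>j. 0 \<le> x $ j + e * v $ j \<and> x $ j + e * v $ j \<le> 1"
    moreover have "(\<Sum>j\<in>UNIV. x $ j + e * v $ j) = real k"
      using x sum0 by (simp add: sum.distrib cube_slice_def flip: sum_distrib_left)
    ultimately show "x + e *\<^sub>R v \<in> cube_slice k"
      by (simp add: cube_slice_def)
  qed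
qed

lemma feasible:
  assumes "x \<in> cube_slice k" "(\<Sum>j\<in>UNIV. v $ j) = 0"
    and "\<And>j. v $ j < 0 \<Longrightarrow> 0 < x $ j" "\<And>j. 0 < v $ j \<Longrightarrow> x $ j < 1"
  obtains e where "e > 0" "x + e *\<^sub>R v \<in> cube_slice k"
proof -
  have "\<forall>\<^sub>F e in at_right 0. x + e *\<^sub>R v \<in> cube_slice k \<and> e \<in> {0<..<1}"
    by (intro eventually_conj eventually_feasible assms eventually_at_right_real) auto
  then have "\<exists>e. x + e *\<^sub>R v \<in> cube_slice k \<and> e \<in> {0<..<1}"
    by (rule eventually_happens'[rotated]) simp
  then show thesis by (auto intro: that)
qed

text \<open>The point \<open>x\<close> is the midpoint of \<open>x + e *\<^sub>R v\<close> and
  \<open>x - e *\<^sub>R v\<close>, both in the slice for small \<open>e\<close>, so the face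
  property puts them into \<open>F\<close>.\<close>

lemma face_contains_fractional_direction:
  assumes F: "F face_of cube_slice k" and x: "x \<in> F" and v: "v \<in> zero_sum_on (fractional x)"
  obtains e where "e > 0" "x + e *\<^sub>R v \<in> F"
proof (cases "v = 0")
  case True
  with x that[of 1] show ?thesis by simp
next
  case False
  have xk: "x \<in> cube_slice k" using F x face_of_imp_subset by blast
  have fr: "0 < x $ j \<and> x $ j < 1" if "v $ j \<noteq> 0" for j
    using v that by (auto simp: zero_sum_on_def fractional_def)
  have "\<forall>\<^sub>F e in at_right 0. (x + e *\<^sub>R v \<in> cube_slice k \<and> x + e *\<^sub>R (- v) \<in> cube_slice k)
      \<and> e \<in> {0<..<1}"
    using v fr
    by (intro eventually_conj eventually_feasible xk eventually_at_right_real)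
       (auto simp: zero_sum_on_def sum_negf)
  from eventually_happens'[OF _ this]
  obtain e where e: "x + e *\<^sub>R v \<in> cube_slice k" "x + e *\<^sub>R (- v) \<in> cube_slice k" "e > 0"
    by auto
  have "x = midpoint (x + e *\<^sub>R v) (x + e *\<^sub>R (- v))"
    by (simp add: midpoint_def flip: scaleR_2)
  moreover have "x + e *\<^sub>R v \<noteq> x + e *\<^sub>R (- v)"
    using False e by (simp add: scaleR_right.minus eq_neg_iff_add_eq_0 flip: scaleR_2)
  ultimately have "x \<in> open_segment (x + e *\<^sub>R v) (x + e *\<^sub>R (- v))"
    using midpoint_in_open_segment by metis
  with face_ofD[OF F this e(1,2) x] e(3) that show ?thesis by blast
qed

lemma cube_slice_eq_box_Int_hyperplane: "cube_slice k = cbox 0 1 \<inter> {x. 1 \<bullet> x = real k}"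
  by (auto simp: cube_slice_def mem_box_cart inner_vec_def)

lemma convex_cube_slice: "convex (cube_slice k)"
  unfolding cube_slice_eq_box_Int_hyperplane by (intro convex_Int convex_box convex_hyperplane)

lemma compact_cube_slice: "compact (cube_slice k)"
  unfolding cube_slice_eq_box_Int_hyperplane
  by (intro compact_Int_closed compact_cbox closed_hyperplane)

text \<open>A single fractional entry is impossible because \<open>k\<close> is an integer, and two
  of them allow a move along the difference of their basis vectors.\<close>

lemma extreme_point_cube_slice:
  assumes "x extreme_point_of cube_slice k"
  shows "fractional x = {}"
proof (rule ccontr)
  assume ne: "fractional x \<noteq> {}"
  have x: "x \<in> cube_slice k" and face: "{x} face_of cube_slice k"
    using assms by (auto simp: extreme_point_of_def face_of_singleton)
  have "card (fractional x) \<ge> 2"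
    using card_ones_fractional[OF x ne] by linarith
  then obtain j l where "j \<in> fractional x" "l \<in> fractional x" "j \<noteq> l"
    by (metis card_2_iff' obtain_subset_with_card_n subset_iff)
  then have "axis j 1 - axis l 1 \<in> zero_sum_on (fractional x)"
    by (auto simp: zero_sum_on_def sum_subtractf) (auto simp: axis_def)
  then obtain e where "e > 0" "x + e *\<^sub>R (axis j 1 - axis l 1) \<in> {x}"
    using face_contains_fractional_direction[OF face] by blast
  with \<open>j \<noteq> l\<close> show False by (simp add: axis_eq_axis)
qed

text \<open>The slice is the hull of its extreme points by Krein-Milman, and these have no
  fractional entries.\<close>

lemma hypersimplex_eq_cube_slice: "hypersimplex k = cube_slice k"
proof
  show "hypersimplex k \<subseteq> cube_slice k"
    unfolding hypersimplex_def
  proof (rule hull_minimal[where S = convex])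
    show "{x. (\<forall>j. x $ j \<in> {0, 1}) \<and> (\<Sum>j\<in>UNIV. x $ j) = real k} \<subseteq> cube_slice k"
      unfolding cube_slice_def by (auto, metis order_refl zero_le_one, metis order_refl zero_le_one)
  qed (rule convex_cube_slice)
next
  have "x \<in> {x. (\<forall>j. x $ j \<in> {0, 1}) \<and> (\<Sum>j\<in>UNIV. x $ j) = real k}"
    if "x extreme_point_of cube_slice k" for x
  proof -
    have "x \<in> cube_slice k" using that by (simp add: extreme_point_of_def)
    moreover have "\<not> (0 < x $ j \<and> x $ j < 1)" for j
      using extreme_point_cube_slice[OF that] by (auto simp: fractional_def)
    ultimately show ?thesis
      by (auto simp: cube_slice_def) (metis order_less_le)
  qed
  then have "convex hull {x. x extreme_point_of cube_slice k} \<subseteq> hypersimplex k"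
    unfolding hypersimplex_def by (intro hull_mono) auto
  then show "cube_slice k \<subseteq> hypersimplex k"
    using Krein_Milman_Minkowski[OF compact_cube_slice convex_cube_slice] by blast
qed

lemma subspace_zero_sum_on: "subspace (zero_sum_on M)"
  by (auto simp: subspace_def zero_sum_on_def sum.distrib simp flip: sum_distrib_left)

text \<open>Intersecting the coordinate subspace of \<open>M\<close> with the zero-sum hyperplane
  costs at most one dimension, and exactly one because a basis vector is lost.\<close>

lemma dim_zero_sum_on:
  assumes "M \<noteq> {}"
  shows "dim (zero_sum_on M :: (real^'n) set) = card M - 1"
proof -
  define S where "S = {v :: real^'n. \<forall>j. j \<notin> M \<longrightarrow> v $ j = 0}"
  define H where "H = {v :: real^'n. 1 \<bullet> v = 0}"
  have eq: "zero_sum_on M = S \<inter> H"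
    by (auto simp: zero_sum_on_def S_def H_def inner_vec_def)
  have sub: "subspace S" "subspace H"
    by (auto simp: S_def H_def subspace_hyperplane) (auto simp: subspace_def)
  have dimS: "dim S = card M"
    unfolding S_def using dim_substandard_cart[where 'a = real and d = M] by (simp add: dim_vec_eq)
  have dimH: "dim H = CARD('n) - 1"
    unfolding H_def by (subst dim_hyperplane) (auto simp: vec_eq_iff)
  from assms obtain a where a: "a \<in> M" by blast
  have "dim (S \<inter> H) < dim S"
  proof (rule dim_psubset)
    have "axis a 1 \<in> S" "axis a 1 \<notin> H"
      using a by (auto simp: S_def H_def inner_axis) (auto simp: axis_def)
    then have "S \<inter> H \<subset> S" by blast
    then show "span (S \<inter> H) \<subset> span S"
      using sub span_eq_iff subspace_inter by metis
  qed
  moreover have "dim {x + y |x y. x \<in> S \<and> y \<in> H} + dim (S \<inter> H) = dim S + dim H"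
    using dim_sums_Int[OF sub] .
  moreover have "dim {x + y |x y. x \<in> S \<and> y \<in> H} \<le> CARD('n)"
    using dim_subset_UNIV_cart by blast
  ultimately show ?thesis
    using eq dimS dimH by simp
qed

text \<open>The direction space of \<open>F\<close> contains
  \<open>zero_sum_on (fractional x)\<close>, whose dimension is one less than the number of
  fractional entries.\<close>

lemma card_fractional_le:
  assumes F: "F face_of cube_slice k" and x: "x \<in> F" and dim: "aff_dim F \<le> int i"
  shows "card (fractional x) \<le> i + 1"
proof (cases "fractional x = {}")
  case False
  have "zero_sum_on (fractional x) \<subseteq> span ((+) (- x) ` F)"
  proof
    fix v assume "v \<in> zero_sum_on (fractional x)"
    then obtain e where e: "e > 0" "x + e *\<^sub>R v \<in> F"
      using face_contains_fractional_direction[OF F x] by blast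
    then have "e *\<^sub>R v \<in> span ((+) (- x) ` F)"
      by (intro span_base) (auto intro!: image_eqI[where x = "x + e *\<^sub>R v"])
    then have "inverse e *\<^sub>R (e *\<^sub>R v) \<in> span ((+) (- x) ` F)"
      by (rule span_scale)
    then show "v \<in> span ((+) (- x) ` F)" using e by simp
  qed
  then have "dim (zero_sum_on (fractional x)) \<le> dim ((+) (- x) ` F)"
    by (metis dim_span dim_subset)
  then show ?thesis
    using dim aff_dim_eq_dim[of x F] x dim_zero_sum_on[OF False] by (auto simp: hull_inc)
qed simp

section \<open>Strict preservation in terms of signs of dependencies\<close>

definition dependencies :: "(real^'n \<Rightarrow> 'b::real_vector) \<Rightarrow> (real^'n) set" where
  "dependencies \<pi> = {v. \<pi> v = 0 \<and> (\<Sum>j\<in>UNIV. v $ j) = 0}"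

text \<open>The positive support is written \<open>negs (- v)\<close>, so that facts about one sign
  transfer by negation.\<close>

definition negs :: "real^'n \<Rightarrow> 'n set" where
  "negs v = {j. v $ j < 0}"

lemma negs_uminus: "negs (- v) = {j. 0 < v $ j}"
  by (simp add: negs_def)

text \<open>The hypothesis \<open>inj\<close> says that the fibre over the image of a point of
  \<open>F\<close> is a single point. For the face property, a segment in the image is lifted to
  \<open>P\<close>; its point over \<open>z'\<close> must then be \<open>z\<close> itself.\<close>

lemma strictly_preservedI:
  assumes \<pi>: "linear \<pi>" and P: "convex P" and F: "F face_of P"
    and inj: "\<And>x y. x \<in> F \<Longrightarrow> y \<in> P \<Longrightarrow> \<pi> x = \<pi> y \<Longrightarrow> x = y"
  shows "strictly_preserved \<pi> P F"
proof -
  have FP: "F \<subseteq> P" using F by (rule face_of_imp_subset)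
  have "(\<pi> ` F) face_of (\<pi> ` P)"
    unfolding face_of_def
  proof (intro conjI ballI impI)
    show "\<pi> ` F \<subseteq> \<pi> ` P" using FP by blast
    show "convex (\<pi> ` F)"
      using \<pi> F by (simp add: convex_linear_image face_of_imp_convex)
    fix a' b' z'
    assume *: "a' \<in> \<pi> ` P" "b' \<in> \<pi> ` P" "z' \<in> \<pi> ` F" "z' \<in> open_segment a' b'"
    then obtain a b z where abz: "a \<in> P" "b \<in> P" "z \<in> F" "a' = \<pi> a" "b' = \<pi> b" "z' = \<pi> z"
      by blast
    from *(4) obtain u where u: "0 < u" "u < 1" "z' = (1 - u) *\<^sub>R a' + u *\<^sub>R b'" and "a' \<noteq> b'"
      by (auto simp: in_segment)
    define c where "c = (1 - u) *\<^sub>R a + u *\<^sub>R b"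
    have "c \<in> P"
      using P abz u unfolding c_def convex_alt by auto
    moreover have "\<pi> z = \<pi> c"
      using u abz by (simp add: c_def linear_add[OF \<pi>] linear_scale[OF \<pi>])
    ultimately have "c \<in> F"
      using inj abz by metis
    moreover have "c \<in> open_segment a b"
      using u \<open>a' \<noteq> b'\<close> abz unfolding in_segment c_def by blast
    ultimately show "a' \<in> \<pi> ` F" "b' \<in> \<pi> ` F"
      using face_ofD[OF F] abz by blast+
  qed
  moreover have "{x \<in> P. \<pi> x \<in> \<pi> ` F} = F"
    using inj FP by (auto, metis)
  moreover have "inj_on \<pi> F"
    using inj FP by (auto intro!: inj_onI)
  ultimately show ?thesis
    by (simp add: strictly_preserved_def inj_on_imp_bij_betw)
qed

text \<open>Two points \<open>x\<close> and \<open>y\<close> with the same image differ by a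
  dependency \<open>y - x\<close>, which is negative only where \<open>x\<close> is positive and
  positive only where \<open>x\<close> is below 1. On a face of dimension at most \<open>i\<close>
  this makes both supports too small.\<close>

lemma strictly_preserved_skeleton:
  fixes \<pi> :: "real^'n \<Rightarrow> 'b::real_vector"
  assumes \<pi>: "linear \<pi>" and F: "F \<in> skeleton i (hypersimplex k)"
    and signs: "\<And>v. v \<in> dependencies \<pi> \<Longrightarrow> v \<noteq> 0 \<Longrightarrow>
      k + i < card (negs v) \<or> CARD('n) + i < card (negs (- v)) + k"
  shows "strictly_preserved \<pi> (hypersimplex k) F"
proof (rule strictly_preservedI[OF \<pi>])
  show "convex (hypersimplex k)"
    by (simp add: hypersimplex_def)
  show face: "F face_of hypersimplex k"
    using F by (simp add: skeleton_def)
  fix x y assume x: "x \<in> F" and y: "y \<in> hypersimplex k" and eq: "\<pi> x = \<pi> y"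
  have xk: "x \<in> cube_slice k" and yk: "y \<in> cube_slice k"
    using face x y face_of_imp_subset hypersimplex_eq_cube_slice by blast+
  let ?O = "{j. x $ j = 1}" and ?M = "fractional x"
  have M: "card ?M \<le> i + 1"
    using card_fractional_le[of F k x i] F x by (simp add: skeleton_def hypersimplex_eq_cube_slice)
  \<comment> \<open>So \<open>x\<close> has at most \<open>k + i\<close> nonzero entries and at
    least \<open>k - i\<close> ones. One unit against \<open>card ?M \<le> i + 1\<close> is gained
    from the strict inequalities around \<open>k\<close>.\<close>
  have O: "card ?O \<le> k \<and> k \<le> card ?O + i \<and> card ?O + card ?M \<le> k + i"
  proof (cases "?M = {}")
    case True
    then show ?thesis using ones_fractional_sum[OF xk] by simp
  next
    case False
    then show ?thesis using card_ones_fractional[OF xk] M by linarith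
  qed
  show "x = y"
  proof (rule ccontr)
    assume "x \<noteq> y"
    moreover have "y - x \<in> dependencies \<pi>"
      using xk yk eq by (simp add: dependencies_def cube_slice_def sum_subtractf linear_diff[OF \<pi>])
    moreover have "card (negs (y - x)) \<le> k + i"
    proof -
      have "negs (y - x) \<subseteq> ?O \<union> ?M"
        using xk yk by (auto simp: negs_def fractional_def cube_slice_def order_less_le)
          (metis order_antisym)+
      then have "card (negs (y - x)) \<le> card (?O \<union> ?M)"
        by (intro card_mono) auto
      also have "\<dots> \<le> card ?O + card ?M"
        by (rule card_Un_le)
      finally show ?thesis using O by linarith
    qed
    moreover have "card (negs (- (y - x))) + k \<le> CARD('n) + i"
    proof -
      have "x $ j \<noteq> 1" if "j \<in> negs (- (y - x))" for j
        using that yk by (auto simp: negs_def cube_slice_def dest: spec[of _ j])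
      then have "negs (- (y - x)) \<inter> ?O = {}" by blast
      then have "card (negs (- (y - x))) + card ?O = card (negs (- (y - x)) \<union> ?O)"
        by (intro card_Un_disjoint[symmetric]) auto
      also have "\<dots> \<le> CARD('n)"
        by (intro card_mono) auto
      finally show ?thesis using O by linarith
    qed
    ultimately show False
      using signs[of "y - x"] by force
  qed
qed

text \<open>A coordinate in the unit interval that takes the value 0 or 1 inside a segment is
  constant along it, so freezing such coordinates cuts out a face. At a vertex the truncated
  difference is 0, as it should be.\<close>

lemma min_face:
  assumes x: "x \<in> cube_slice k"
  defines "F \<equiv> {y \<in> cube_slice k. \<forall>j. j \<notin> fractional x \<longrightarrow> y $ j = x $ j}"
  shows "F face_of cube_slice k" and "aff_dim F \<le> int (card (fractional x) - 1)"
proof -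
  show "F face_of cube_slice k"
    unfolding face_of_def
  proof (intro conjI ballI impI)
    show "F \<subseteq> cube_slice k" by (auto simp: F_def)
    have "F = cube_slice k \<inter> (\<Inter>j\<in>- fractional x. {y. y $ j = x $ j})"
      by (auto simp: F_def)
    moreover have "convex {y. y $ j = c}" for j and c :: real
      by (auto simp: convex_def simp flip: distrib_right)
    ultimately show "convex F"
      by (auto intro!: convex_Int convex_INT convex_cube_slice)
    fix a b z assume *: "a \<in> cube_slice k" "b \<in> cube_slice k" "z \<in> F" "z \<in> open_segment a b"
    then obtain u where u: "0 < u" "u < 1" and z: "z = (1 - u) *\<^sub>R a + u *\<^sub>R b"
      by (auto simp: in_segment)
    have "a $ j = x $ j \<and> b $ j = x $ j" if "j \<notin> fractional x" for j
    proof -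
      have ab: "0 \<le> a $ j" "a $ j \<le> 1" "0 \<le> b $ j" "b $ j \<le> 1"
        using * by (auto simp: cube_slice_def)
      have zj: "(1 - u) * a $ j + u * b $ j = x $ j"
        using *(3) that z by (auto simp: F_def)
      have "x $ j = 0 \<or> x $ j = 1"
        using x that by (auto simp: cube_slice_def fractional_def order_less_le)
      then show ?thesis
      proof
        assume 0: "x $ j = 0"
        have "0 \<le> (1 - u) * a $ j" "0 \<le> u * b $ j" using ab u by auto
        with zj 0 have "(1 - u) * a $ j = 0" "u * b $ j = 0" by linarith+
        with u 0 show ?thesis by simp
      next
        assume 1: "x $ j = 1"
        have "0 \<le> (1 - u) * (1 - a $ j)" "0 \<le> u * (1 - b $ j)" using ab u by auto
        moreover have "(1 - u) * (1 - a $ j) + u * (1 - b $ j) = 0"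
          using zj 1 by (simp add: algebra_simps)
        ultimately have "(1 - u) * (1 - a $ j) = 0" "u * (1 - b $ j) = 0" by linarith+
        with u 1 show ?thesis by simp
      qed
    qed
    with * show "a \<in> F" "b \<in> F" by (auto simp: F_def)
  qed
  have xF: "x \<in> F" using x by (simp add: F_def)
  have "(+) (- x) ` F \<subseteq> zero_sum_on (fractional x)"
    using x by (auto simp: F_def zero_sum_on_def cube_slice_def sum_subtractf)
  then have "dim ((+) (- x) ` F) \<le> dim (zero_sum_on (fractional x))"
    by (rule dim_subset)
  also have "\<dots> \<le> card (fractional x) - 1"
  proof (cases "fractional x = {}")
    case True
    then have "zero_sum_on (fractional x) \<subseteq> {0}"
      by (auto simp: zero_sum_on_def vec_eq_iff)
    then show ?thesis using dim_eq_0 by (metis le0)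
  qed (simp add: dim_zero_sum_on)
  finally show "aff_dim F \<le> int (card (fractional x) - 1)"
    using aff_dim_eq_dim[of x F] xF by (simp add: hull_inc)
qed

text \<open>If \<open>N = k + t\<close> with \<open>t > 0\<close>, the point has \<open>k - 1\<close> ones inside the negative support of
  \<open>v\<close> and the value \<open>1 / (t + 1)\<close> on the rest of it; a positive support that is too large is
  treated dually.\<close>

lemma blocking_point:
  fixes v :: "real^'n"
  assumes k: "1 \<le> k" "k < CARD('n)"
    and N: "card (negs v) \<le> k + i" and P: "card (negs (- v)) + k \<le> CARD('n) + i"
  obtains x where "x \<in> cube_slice k" "card (fractional x) \<le> i + 1"
    "\<And>j. v $ j < 0 \<Longrightarrow> 0 < x $ j" "\<And>j. 0 < v $ j \<Longrightarrow> x $ j < 1"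
proof -
  note witness = that
  have disj: "negs v \<inter> negs (- v) = {}"
    by (auto simp: negs_def)
  have NP: "card (negs v) + card (negs (- v)) \<le> CARD('n)"
    using card_Un_disjoint[OF _ _ disj] card_mono[of UNIV "negs v \<union> negs (- v)"] by simp
  have main: thesis if BM: "B \<inter> M = {}" "negs v \<subseteq> B \<union> M" "B \<inter> negs (- v) = {}"
    and M: "card M \<le> i + 1" and c: "real k = real (card B) + c * real (card M)" "M = {} \<or> 0 < c \<and> c < 1"
  for B M c
  proof -
    define x :: "real^'n" where "x = (\<chi> j. if j \<in> B then 1 else if j \<in> M then c else 0)"
    have "(\<Sum>j\<in>UNIV. x $ j) = (\<Sum>j\<in>UNIV. (if j \<in> B then 1 else 0) + (if j \<in> M then c else 0))"
      using BM by (intro sum.cong) (auto simp: x_def)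
    also have "\<dots> = real k"
      using c by (simp add: sum.distrib sum.If_cases mult.commute)
    finally have "x \<in> cube_slice k"
      using c(2) by (auto simp: cube_slice_def x_def)
    moreover have "fractional x \<subseteq> M" by (auto simp: fractional_def x_def split: if_splits)
    then have "card (fractional x) \<le> i + 1" using M card_mono[of M "fractional x"] by simp
    moreover have "0 < x $ j" if "v $ j < 0" for j
      using that BM c(2) by (auto simp: x_def negs_def)
    moreover have "x $ j < 1" if "0 < v $ j" for j
      using that BM c(2) by (auto simp: x_def negs_uminus)
    ultimately show thesis by (rule witness)
  qed
  consider "k < card (negs v)" | "CARD('n) - k < card (negs (- v))"
    | "card (negs v) \<le> k" "k \<le> CARD('n) - card (negs (- v))"
    using k by linarith
  then show thesis
  proof cases
    case 1
    obtain B where B: "B \<subseteq> negs v" "card B = k - 1"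
      by (rule obtain_subset_with_card_n[of "k - 1" "negs v"]) (use 1 in auto)
    define M where "M = negs v - B"
    have cM: "card M = card (negs v) - (k - 1)"
      unfolding M_def using B by (simp add: card_Diff_subset finite_subset)
    then have c2: "2 \<le> card M" using 1 k by linarith
    show thesis
    proof (rule main)
      show "B \<inter> M = {}" "negs v \<subseteq> B \<union> M" "B \<inter> negs (- v) = {}"
        using B disj by (auto simp: M_def)
      show "card M \<le> i + 1" using cM N by linarith
      show "real k = real (card B) + 1 / real (card M) * real (card M)"
        using c2 B(2) k by (auto simp: of_nat_diff)
      show "M = {} \<or> 0 < 1 / real (card M) \<and> 1 / real (card M) < 1"
        using c2 by simp
    qed
  next
    case 2
    obtain A where A: "A \<subseteq> negs (- v)" "card A = CARD('n) - k - 1"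
      by (rule obtain_subset_with_card_n[of "CARD('n) - k - 1" "negs (- v)"]) (use 2 in auto)
    define M where "M = negs (- v) - A"
    define B where "B = - negs (- v)"
    have cM: "card M = card (negs (- v)) - (CARD('n) - k - 1)"
      unfolding M_def using A by (simp add: card_Diff_subset finite_subset)
    have cB: "card B = CARD('n) - card (negs (- v))"
      by (simp add: B_def Compl_eq_Diff_UNIV card_Diff_subset)
    have cBk: "card B + card M = k + 1"
      using cM cB 2 k NP by linarith
    have cM2: "card M \<ge> 2" using cM 2 k by linarith
    show thesis
    proof (rule main)
      show "B \<inter> M = {}" "negs v \<subseteq> B \<union> M" "B \<inter> negs (- v) = {}"
        using disj by (auto simp: B_def M_def)
      show "card M \<le> i + 1" using cM P by linarith
      \<comment> \<open>Each entry on \<open>M\<close> falls short of 1 by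
        \<open>1 / card M\<close>, so the total is \<open>card B + card M - 1\<close>, which is
        \<open>k\<close> by \<open>cBk\<close>.\<close>
      show "real k = real (card B) + (real (card M) - 1) / real (card M) * real (card M)"
        using cM2 cBk by auto
      show "M = {} \<or> 0 < (real (card M) - 1) / real (card M) \<and> (real (card M) - 1) / real (card M) < 1"
        using cM2 by auto
    qed
  next
    case 3
    \<comment> \<open>Neither support is too large here, so a vertex suffices: its ones cover the
      negative support and avoid the positive one.\<close>
    obtain B where B: "negs v \<subseteq> B" "B \<subseteq> - negs (- v)" "card B = k"
      using exists_subset_between[of "negs v" k "- negs (- v)"] 3 disj by (auto simp: Compl_eq_Diff_UNIV card_Diff_subset)
    show thesis
      by (rule main[of B "{}" 0]) (use B in auto)
  qed
qed

text \<open>If both supports were small, the blocking point \<open>x\<close> would lie in a face of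
  dimension at most \<open>i\<close> and could move a little along \<open>v\<close> without changing
  its image. Strict preservation keeps the moved point in that face, and injectivity there forces
  \<open>v = 0\<close>.\<close>

lemma signs_of_preserved_skeleton:
  fixes \<pi> :: "real^'n \<Rightarrow> 'b::real_vector"
  assumes \<pi>: "linear \<pi>" and k: "1 \<le> k" "k < CARD('n)"
    and pres: "\<And>F. F \<in> skeleton i (hypersimplex k) \<Longrightarrow> strictly_preserved \<pi> (hypersimplex k) F"
    and v: "v \<in> dependencies \<pi>" "v \<noteq> 0"
  shows "k + i < card (negs v) \<or> CARD('n) + i < card (negs (- v)) + k"
proof (rule ccontr)
  assume "\<not> ?thesis"
  then obtain x where x: "x \<in> cube_slice k" and M: "card (fractional x) \<le> i + 1"
    and sgn: "\<And>j. v $ j < 0 \<Longrightarrow> 0 < x $ j" "\<And>j. 0 < v $ j \<Longrightarrow> x $ j < 1"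
    using blocking_point[OF k, of v i] by (metis linorder_not_less)
  define F where "F = {y \<in> cube_slice k. \<forall>j. j \<notin> fractional x \<longrightarrow> y $ j = x $ j}"
  have "F \<in> skeleton i (hypersimplex k)"
    using min_face[OF x] M by (auto simp: skeleton_def hypersimplex_eq_cube_slice F_def)
  then have pF: "strictly_preserved \<pi> (cube_slice k) F"
    using pres by (simp add: hypersimplex_eq_cube_slice)
  obtain e where e: "e > 0" "x + e *\<^sub>R v \<in> cube_slice k"
    using feasible[OF x _ sgn] v by (auto simp: dependencies_def)
  have eq: "\<pi> (x + e *\<^sub>R v) = \<pi> x"
    using v by (simp add: dependencies_def linear_add[OF \<pi>] linear_scale[OF \<pi>])
  have xF: "x \<in> F" using x by (simp add: F_def)
  then have "x + e *\<^sub>R v \<in> F"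
    using pF e eq by (auto simp: strictly_preserved_def)
  with xF eq pF have "x + e *\<^sub>R v = x"
    by (meson bij_betw_imp_inj_on inj_onD strictly_preserved_def)
  with e v show False by simp
qed

section \<open>Convex position in terms of signs of dependencies\<close>

lemma linear_axis_expansion:
  fixes v :: "real^'n"
  assumes "linear \<pi>"
  shows "\<pi> v = (\<Sum>j\<in>UNIV. v $ j *\<^sub>R \<pi> (axis j 1))"
proof -
  have "v = (\<Sum>j\<in>UNIV. v $ j *\<^sub>R axis j 1)"
    by (simp add: vec_eq_iff axis_def if_distrib cong: if_cong)
  then have "\<pi> v = \<pi> (\<Sum>j\<in>UNIV. v $ j *\<^sub>R axis j 1)" by simp
  also have "\<dots> = (\<Sum>j\<in>UNIV. v $ j *\<^sub>R \<pi> (axis j 1))"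
    by (simp only: linear_sum[OF assms] linear_scale[OF assms])
  finally show ?thesis .
qed

lemma negs_nonempty:
  assumes "(\<Sum>j\<in>UNIV. v $ j) = 0" "v \<noteq> 0"
  shows "negs v \<noteq> {}"
proof
  assume "negs v = {}"
  then have "\<forall>j. 0 \<le> v $ j" by (auto simp: negs_def not_less)
  with assms have "\<forall>j. v $ j = 0" by (simp add: sum_nonneg_eq_0_iff)
  with assms show False by (simp add: vec_eq_iff)
qed

lemma uminus_dependencies:
  assumes "linear \<pi>" "v \<in> dependencies \<pi>"
  shows "- v \<in> dependencies \<pi>"
  using assms linear_neg[OF assms(1), of v] by (simp add: dependencies_def sum_negf)

text \<open>A dependency whose only negative entry is at \<open>j\<close>, divided by
  \<open>- v $ j\<close>, writes the point with index \<open>j\<close> as a convex combination of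
  the others.\<close>

lemma card_negs_of_convex_position:
  fixes \<pi> :: "real^'n \<Rightarrow> 'b::real_vector"
  assumes \<pi>: "linear \<pi>" and conv: "convex_position (\<lambda>j. \<pi> (axis j 1))"
    and v: "v \<in> dependencies \<pi>" "v \<noteq> 0"
  shows "2 \<le> card (negs v)"
proof (rule ccontr)
  assume "\<not> ?thesis"
  moreover have "card (negs v) \<noteq> 0"
    using negs_nonempty[of v] v by (simp add: dependencies_def)
  ultimately obtain j where j: "negs v = {j}"
    by (metis One_nat_def card_1_singletonE less_2_cases not_le)
  have vj: "v $ j < 0" using j by (auto simp: negs_def)
  have nonneg: "0 \<le> v $ l" if "l \<noteq> j" for l
    using j that by (metis leI mem_Collect_eq negs_def singletonD)
  define u where "u l = v $ l / (- v $ j)" for l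
  have "(\<Sum>l\<in>UNIV - {j}. v $ l) = - v $ j"
    using v by (simp add: dependencies_def sum_diff1)
  then have "(\<Sum>l\<in>UNIV - {j}. u l) = 1"
    unfolding u_def sum_divide_distrib[symmetric] using vj by simp
  then have "(\<Sum>l\<in>UNIV - {j}. u l *\<^sub>R \<pi> (axis l 1)) \<in> convex hull ((\<lambda>l. \<pi> (axis l 1)) ` (UNIV - {j}))"
    using vj nonneg by (intro convex_sum) (auto simp: u_def hull_inc divide_nonneg_neg)
  moreover have "(\<Sum>l\<in>UNIV - {j}. u l *\<^sub>R \<pi> (axis l 1)) = \<pi> (axis j 1)"
  proof -
    have "0 = (\<Sum>l\<in>UNIV. v $ l *\<^sub>R \<pi> (axis l 1))"
      using v linear_axis_expansion[OF \<pi>, of v] by (simp add: dependencies_def)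
    also have "\<dots> = v $ j *\<^sub>R \<pi> (axis j 1) + (\<Sum>l\<in>UNIV - {j}. v $ l *\<^sub>R \<pi> (axis l 1))"
      by (rule sum.remove) auto
    finally have *: "(\<Sum>l\<in>UNIV - {j}. v $ l *\<^sub>R \<pi> (axis l 1)) = (- v $ j) *\<^sub>R \<pi> (axis j 1)"
      by (simp add: eq_neg_iff_add_eq_0 add.commute)
    have "(\<Sum>l\<in>UNIV - {j}. u l *\<^sub>R \<pi> (axis l 1))
        = (1 / (- v $ j)) *\<^sub>R (\<Sum>l\<in>UNIV - {j}. v $ l *\<^sub>R \<pi> (axis l 1))"
      by (simp add: u_def scaleR_sum_right)
    also have "\<dots> = \<pi> (axis j 1)"
      unfolding * using vj by simp
    finally show ?thesis .
  qed
  ultimately show False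
    using conv by (auto simp: convex_position_def)
qed

text \<open>Conversely, coefficients \<open>u\<close> of such a convex combination give the
  dependency \<open>u - axis j 1\<close> with a single negative entry. Distinctness follows, since a
  repeated point lies in the hull of the others.\<close>

lemma convex_positionI:
  fixes \<pi> :: "real^'n \<Rightarrow> 'b::real_vector"
  assumes \<pi>: "linear \<pi>" and negs: "\<And>v. v \<in> dependencies \<pi> \<Longrightarrow> v \<noteq> 0 \<Longrightarrow> 2 \<le> card (negs v)"
  shows "convex_position (\<lambda>j. \<pi> (axis j 1))"
proof -
  have notin: "\<pi> (axis j 1) \<notin> convex hull ((\<lambda>l. \<pi> (axis l 1)) ` (UNIV - {j}))" for j
  proof
    assume *: "\<pi> (axis j 1) \<in> convex hull ((\<lambda>l. \<pi> (axis l 1)) ` (UNIV - {j}))"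
    define U where "U = {u :: real^'n. u $ j = 0 \<and> (\<forall>l. 0 \<le> u $ l) \<and> (\<Sum>l\<in>UNIV. u $ l) = 1}"
    have "convex hull ((\<lambda>l. \<pi> (axis l 1)) ` (UNIV - {j}))
        = \<pi> ` (convex hull ((\<lambda>l. axis l 1) ` (UNIV - {j})))"
      by (simp only: convex_hull_linear_image[OF \<pi>] image_image)
    also have "\<dots> \<subseteq> \<pi> ` U"
    proof (intro image_mono hull_minimal)
      show "(\<lambda>l. axis l 1) ` (UNIV - {j}) \<subseteq> U"
        by (auto simp: U_def) (auto simp: axis_def)
      show "convex U"
        by (auto simp: U_def convex_def sum.distrib simp flip: sum_distrib_left)
    qed
    finally obtain u where u: "u \<in> U" "\<pi> u = \<pi> (axis j 1)"
      using * by auto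
    define v where "v = u - axis j 1"
    have "v \<in> dependencies \<pi>"
      using u by (simp add: v_def dependencies_def linear_diff[OF \<pi>] U_def sum_subtractf)
         (simp add: axis_def)
    moreover have "v $ j = - 1" using u by (simp add: v_def U_def)
    then have "v \<noteq> 0" by auto
    moreover have "negs v \<subseteq> {j}"
      using u by (auto simp: negs_def v_def U_def axis_def not_less[symmetric] split: if_splits)
    then have "card (negs v) \<le> 1"
      using card_mono[of "{j}" "negs v"] by simp
    ultimately show False using negs[of v] by simp
  qed
  have "inj (\<lambda>j. \<pi> (axis j 1))"
  proof (rule injI, rule ccontr)
    fix j l assume "\<pi> (axis j 1) = \<pi> (axis l 1)" "j \<noteq> l"
    then have "\<pi> (axis j 1) \<in> (\<lambda>l. \<pi> (axis l 1)) ` (UNIV - {j})" by auto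
    then show False using notin[of j] by (meson hull_inc)
  qed
  with notin show ?thesis by (simp add: convex_position_def)
qed

section \<open>Lower bounds on the target dimension\<close>

lemma subspace_dependencies:
  assumes "linear \<pi>"
  shows "subspace (dependencies \<pi>)"
  by (rule subspaceI)
     (auto simp: dependencies_def linear_0[OF assms] linear_add[OF assms] linear_scale[OF assms]
       sum.distrib simp flip: sum_distrib_left)

text \<open>The dependencies contain the orthogonal complement of \<open>d + 1\<close> vectors: the
  all-ones vector and the \<open>d\<close> coordinate functionals of \<open>\<pi>\<close>.\<close>

lemma dim_dependencies:
  fixes \<pi> :: "real^'n \<Rightarrow> (nat \<Rightarrow>\<^sub>0 real)"
  assumes \<pi>: "linear \<pi>" and range: "range \<pi> \<subseteq> coord_space d"
  shows "CARD('n) \<le> dim (dependencies \<pi>) + d + 1"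
proof -
  define c :: "nat \<Rightarrow> real^'n" where "c m = (\<chi> j. Poly_Mapping.lookup (\<pi> (axis j 1)) m)" for m
  have lookup: "Poly_Mapping.lookup (\<pi> v) m = c m \<bullet> v" for v m
    by (subst linear_axis_expansion[OF \<pi>])
       (simp add: lookup_sum lookup_scaleR_poly_mapping c_def inner_vec_def mult.commute)
  define A where "A = span (insert 1 (c ` {..<d}))"
  have "dim {y \<in> UNIV. \<forall>x\<in>A. orthogonal x y} + dim A = dim (UNIV :: (real^'n) set)"
    by (rule dim_subspace_orthogonal_to_vectors) (auto simp: A_def)
  moreover have "dim A \<le> d + 1"
  proof -
    have "dim A \<le> card (insert 1 (c ` {..<d}))"
      unfolding A_def dim_span by (rule dim_le_card') simp
    also have "\<dots> \<le> card (c ` {..<d}) + 1"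
      by (simp add: card_insert_if)
    also have "card (c ` {..<d}) \<le> d"
      using card_image_le[of "{..<d}" c] by simp
    finally show ?thesis by simp
  qed
  moreover have "{y \<in> UNIV. \<forall>x\<in>A. orthogonal x y} \<subseteq> dependencies \<pi>"
  proof
    fix y assume "y \<in> {y \<in> UNIV. \<forall>x\<in>A. orthogonal x y}"
    then have y: "x \<bullet> y = 0" if "x \<in> insert 1 (c ` {..<d})" for x
      using span_base[OF that] unfolding A_def orthogonal_def by simp
    have "Poly_Mapping.lookup (\<pi> y) m = 0" for m
    proof (cases "m < d")
      case True
      then show ?thesis using y by (simp add: lookup)
    next
      case False
      have "Poly_Mapping.keys (\<pi> y) \<subseteq> {..<d}"
        using range by (auto simp: coord_space_def)
      with False show ?thesis by (auto simp: in_keys_iff)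
    qed
    then have "\<pi> y = 0" by (intro poly_mapping_eqI) simp
    moreover have "(\<Sum>j\<in>UNIV. y $ j) = 0"
      using y[of 1] by (simp add: inner_vec_def)
    ultimately show "y \<in> dependencies \<pi>" by (simp add: dependencies_def)
  qed
  then have "dim {y \<in> UNIV. \<forall>x\<in>A. orthogonal x y} \<le> dim (dependencies \<pi>)"
    by (rule dim_subset)
  ultimately show ?thesis by simp
qed

text \<open>A coordinate subspace of dimension \<open>CARD('n) + 1 - dim K\<close> meets
  \<open>K\<close> nontrivially by the dimension formula.\<close>

lemma small_support_vector:
  fixes K :: "(real^'n) set"
  assumes K: "subspace K" and dim: "1 \<le> dim K"
  obtains v where "v \<in> K" "v \<noteq> 0" "card {j. v $ j \<noteq> 0} + dim K \<le> CARD('n) + 1"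
proof -
  have "dim K \<le> CARD('n)"
    using dim_subset_UNIV_cart by blast
  obtain T :: "'n set" where T: "card T = CARD('n) + 1 - dim K"
    by (rule obtain_subset_with_card_n[of "CARD('n) + 1 - dim K" "UNIV :: 'n set"]) (use dim in auto)
  define S where "S = {v :: real^'n. \<forall>j. j \<notin> T \<longrightarrow> v $ j = 0}"
  have S: "subspace S" "dim S = card T"
    unfolding S_def using dim_substandard_cart[where 'a = real and d = T]
    by (auto simp: dim_vec_eq) (auto simp: subspace_def)
  have "dim {x + y |x y. x \<in> S \<and> y \<in> K} + dim (S \<inter> K) = dim S + dim K"
    using dim_sums_Int[OF S(1) K] .
  moreover have "dim {x + y |x y. x \<in> S \<and> y \<in> K} \<le> CARD('n)"
    using dim_subset_UNIV_cart by blast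
  ultimately have "dim (S \<inter> K) \<noteq> 0"
    using T S(2) \<open>dim K \<le> CARD('n)\<close> by linarith
  then obtain v where v: "v \<in> S" "v \<in> K" "v \<noteq> 0"
    by (auto simp: dim_eq_0)
  have "{j. v $ j \<noteq> 0} \<subseteq> T"
    using v(1) by (auto simp: S_def)
  then have "card {j. v $ j \<noteq> 0} \<le> card T"
    by (intro card_mono) auto
  with v T \<open>dim K \<le> CARD('n)\<close> that show thesis by force
qed

lemma card_negs_add: "card (negs v) + card (negs (- v)) = card {j. v $ j \<noteq> 0}"
proof -
  have "card (negs v \<union> negs (- v)) = card (negs v) + card (negs (- v))"
    by (rule card_Un_disjoint) (auto simp: negs_def)
  moreover have "negs v \<union> negs (- v) = {j. v $ j \<noteq> 0}"
    by (auto simp: negs_def)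
  ultimately show ?thesis by simp
qed

lemma card_negs_add_le: "card (negs v) + card (negs (- v)) \<le> CARD('n)" for v :: "real^'n"
  unfolding card_negs_add by (intro card_mono) auto

text \<open>Negative entries stay negative under small perturbations, so the negative support can
  only grow.\<close>

lemma open_card_negs_ge: "open {v :: real^'n. a \<le> card (negs v)}"
proof -
  have "{v :: real^'n. a \<le> card (negs v)} = (\<Union>A\<in>{A. a \<le> card A}. \<Inter>j\<in>A. {v. v $ j < 0})"
  proof (intro set_eqI iffI)
    fix v :: "real^'n"
    assume "v \<in> {v. a \<le> card (negs v)}"
    then show "v \<in> (\<Union>A\<in>{A. a \<le> card A}. \<Inter>j\<in>A. {v. v $ j < 0})"
      by (auto simp: negs_def)
  next
    fix v :: "real^'n"
    assume "v \<in> (\<Union>A\<in>{A. a \<le> card A}. \<Inter>j\<in>A. {v. v $ j < 0})"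
    then obtain A where "a \<le> card A" "A \<subseteq> negs v"
      by (auto simp: negs_def)
    then show "v \<in> {v. a \<le> card (negs v)}"
      using card_mono[of "negs v" A] by simp
  qed
  moreover have "open {v :: real^'n. v $ j < 0}" for j
    by (intro open_Collect_less continuous_intros)
  ultimately show ?thesis by (simp add: open_INT open_UN)
qed

lemma open_card_pos_ge: "open {v :: real^'n. a \<le> card (negs (- v))}"
proof -
  have "{v :: real^'n. a \<le> card (negs (- v))} = uminus ` {v. a \<le> card (negs v)}"
    by (auto intro!: image_eqI[where x = "- _"])
  then show ?thesis
    by (simp add: open_negations open_card_negs_ge)
qed

text \<open>A path from \<open>v\<close> to \<open>- v\<close> inside \<open>K - {0}\<close> cannot leave the open set in which it starts, and
  \<open>v \<mapsto> - v\<close> exchanges the two unbalanced sets.\<close>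

lemma balanced_if_dim_ge_2:
  fixes K :: "(real^'n) set"
  assumes K: "subspace K" and dim: "2 \<le> dim K"
    and ab: "CARD('n) < a + b" "CARD('n) < 2 * b"
    and signs: "\<And>v. v \<in> K \<Longrightarrow> v \<noteq> 0 \<Longrightarrow>
      a \<le> card (negs v) \<and> a \<le> card (negs (- v)) \<or> b \<le> card (negs v) \<or> b \<le> card (negs (- v))"
    and v: "v \<in> K" "v \<noteq> 0"
  shows "a \<le> card (negs v)"
proof -
  define Y where "Y = {v :: real^'n. b \<le> card (negs v)}"
  define Z where "Z = {v :: real^'n. a \<le> card (negs v)} \<inter> {v. a \<le> card (negs (- v))}
    \<union> {v. b \<le> card (negs (- v))}"
  \<comment> \<open>A convex set with a point removed can be disconnected only in dimension
    one.\<close>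
  have "aff_dim K \<noteq> 1"
    using dim K by (simp add: aff_dim_subspace)
  then have "connected (K - {0})"
    using K by (intro connected_punctured_convex subspace_imp_convex)
  moreover have "open Y" "open Z"
    unfolding Y_def Z_def by (intro open_Un open_Int open_card_negs_ge open_card_pos_ge)+
  \<comment> \<open>By \<open>ab\<close>, a common element would have more than
    \<open>CARD('n)\<close> nonzero entries.\<close>
  moreover have "Y \<inter> Z \<inter> (K - {0}) = {}"
  proof -
    have False if "w \<in> Y" "w \<in> Z" for w
      using that card_negs_add_le[of w] ab by (auto simp: Y_def Z_def)
    then show ?thesis by blast
  qed
  moreover have "K - {0} \<subseteq> Y \<union> Z"
    using signs by (auto simp: Y_def Z_def)
  ultimately have sep: "Y \<inter> (K - {0}) = {} \<or> Z \<inter> (K - {0}) = {}"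
    by (rule connectedD)
  have notY: "w \<notin> Y" if w: "w \<in> K" "w \<noteq> 0" for w
  proof
    assume "w \<in> Y"
    then have "- w \<in> Z" by (simp add: Y_def Z_def)
    moreover have "- w \<in> K - {0}" using w K by (simp add: subspace_neg)
    ultimately show False using sep w \<open>w \<in> Y\<close> by blast
  qed
  from notY[OF v] notY[of "- v"] v K signs[OF v] show ?thesis
    by (auto simp: Y_def subspace_neg)
qed

text \<open>First claim: either there is at most one independent dependency, or all are balanced and
  one of small support bounds their dimension. Second claim: a nonzero dependency is balanced, or
  one support has \<open>CARD('n) - m + i + 1\<close> elements while convex position reserves two
  for the other.\<close>

lemma good_projection_dims:
  fixes \<pi> :: "real^'n \<Rightarrow> (nat \<Rightarrow>\<^sub>0 real)"
  assumes good: "good_projection k i d \<pi>" and k: "1 \<le> k" "k < CARD('n)"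
    and m: "m = min k (CARD('n) - k)"
  shows "CARD('n) \<le> d + 2 \<or> 2 * m + 2 * i \<le> d"
    and "CARD('n) \<le> d + 1 \<or> 2 * m + 2 * i + 2 \<le> CARD('n) \<or> i + 3 \<le> m"
proof -
  let ?K = "dependencies \<pi>"
  have \<pi>: "linear \<pi>" and range: "range \<pi> \<subseteq> coord_space d"
    and pres: "\<And>F. F \<in> skeleton i (hypersimplex k) \<Longrightarrow> strictly_preserved \<pi> (hypersimplex k) F"
    and conv: "convex_position (\<lambda>j. \<pi> (axis j 1))"
    using good by (auto simp: good_projection_def)
  have K: "subspace ?K" by (rule subspace_dependencies[OF \<pi>])
  have dimK: "CARD('n) \<le> dim ?K + d + 1" by (rule dim_dependencies[OF \<pi> range])
  \<comment> \<open>Thresholds for balanced and unbalanced dependencies. Applying the sign condition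
    to \<open>v\<close> and to \<open>- v\<close> makes it symmetric in \<open>k\<close> and
    \<open>CARD('n) - k\<close>, so only \<open>m\<close> enters.\<close>
  define a b where "a = m + i + 1" and "b = CARD('n) - m + i + 1"
  have signs: "a \<le> card (negs v) \<and> a \<le> card (negs (- v)) \<or> b \<le> card (negs v) \<or> b \<le> card (negs (- v))"
    if v: "v \<in> ?K" "v \<noteq> 0" for v
  proof -
    have "k + i < card (negs v) \<or> CARD('n) + i < card (negs (- v)) + k"
      using signs_of_preserved_skeleton[OF \<pi> k pres v] .
    moreover have "k + i < card (negs (- v)) \<or> CARD('n) + i < card (negs (- (- v))) + k"
      using v by (intro signs_of_preserved_skeleton[OF \<pi> k pres] uminus_dependencies[OF \<pi>]) auto
    ultimately show ?thesis
      using k unfolding a_def b_def m min_def by (auto split: if_splits)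
  qed
  have balanced: "dim ?K + 2 * m + 2 * i + 1 \<le> CARD('n)" if dim2: "2 \<le> dim ?K"
  proof -
    obtain v where v: "v \<in> ?K" "v \<noteq> 0" "card {j. v $ j \<noteq> 0} + dim ?K \<le> CARD('n) + 1"
      using small_support_vector[OF K] dim2 by (metis le_trans one_le_numeral)
    have ab: "CARD('n) < a + b" "CARD('n) < 2 * b"
      using k unfolding a_def b_def m by auto
    have "a \<le> card (negs v)" "a \<le> card (negs (- v))"
      using balanced_if_dim_ge_2[OF K dim2 ab signs] v uminus_dependencies[OF \<pi>] by auto
    with v(3) show ?thesis
      unfolding card_negs_add[symmetric] a_def by linarith
  qed
  show "CARD('n) \<le> d + 2 \<or> 2 * m + 2 * i \<le> d"
    using balanced dimK by linarith
  show "CARD('n) \<le> d + 1 \<or> 2 * m + 2 * i + 2 \<le> CARD('n) \<or> i + 3 \<le> m"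
  proof (cases "dim ?K = 0")
    case True
    then show ?thesis using dimK by linarith
  next
    case False
    then obtain v where v: "v \<in> ?K" "v \<noteq> 0" by (auto simp: dim_eq_0)
    have "2 \<le> card (negs v)" "2 \<le> card (negs (- v))"
      using card_negs_of_convex_position[OF \<pi> conv] v uminus_dependencies[OF \<pi>] by auto
    with signs[OF v] card_negs_add_le[of v] k show ?thesis
      unfolding a_def b_def m by linarith
  qed
qed

section \<open>Constructions attaining the bounds\<close>

text \<open>Reduces a construction to choosing \<open>d\<close> functionals \<open>c m\<close>, the
  coordinates of \<open>\<pi>\<close>, and checking signs on their common zero-sum kernel.\<close>

lemma good_projectionI:
  fixes c :: "nat \<Rightarrow> real^'n"
  assumes "\<And>v. v \<noteq> 0 \<Longrightarrow> (\<Sum>j\<in>UNIV. v $ j) = 0 \<Longrightarrow> (\<And>m. m < d \<Longrightarrow> c m \<bullet> v = 0) \<Longrightarrow>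
    2 \<le> card (negs v) \<and> (k + i < card (negs v) \<or> CARD('n) + i < card (negs (- v)) + k)"
  shows "\<exists>\<pi> :: real^'n \<Rightarrow> (nat \<Rightarrow>\<^sub>0 real). good_projection k i d \<pi>"
proof -
  define \<pi> :: "real^'n \<Rightarrow> (nat \<Rightarrow>\<^sub>0 real)"
    where "\<pi> v = (\<Sum>m<d. (c m \<bullet> v) *\<^sub>R Poly_Mapping.single m 1)" for v
  have lookup: "Poly_Mapping.lookup (\<pi> v) m = (if m < d then c m \<bullet> v else 0)" for v m
    unfolding \<pi>_def
    by (simp add: lookup_sum lookup_scaleR_poly_mapping lookup_single when_def if_distrib cong: if_cong)
  have lin: "linear \<pi>"
    unfolding \<pi>_def
    by (rule linearI) (simp_all add: inner_add_right scaleR_add_left sum.distrib scaleR_sum_right)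
  have "range \<pi> \<subseteq> coord_space d"
    by (auto simp: coord_space_def in_keys_iff lookup split: if_splits)
  moreover have dep: "2 \<le> card (negs v) \<and> (k + i < card (negs v) \<or> CARD('n) + i < card (negs (- v)) + k)"
    if "v \<in> dependencies \<pi>" "v \<noteq> 0" for v
  proof (rule assms)
    show "v \<noteq> 0" "(\<Sum>j\<in>UNIV. v $ j) = 0"
      using that by (auto simp: dependencies_def)
    have "\<pi> v = 0" using that by (simp add: dependencies_def)
    then show "c m \<bullet> v = 0" if "m < d" for m
      using lookup[of v m] that by simp
  qed
  moreover have "convex_position (\<lambda>j. \<pi> (axis j 1))"
    using dep by (intro convex_positionI[OF lin]) blast
  moreover have "strictly_preserved \<pi> (hypersimplex k) F" if "F \<in> skeleton i (hypersimplex k)" for F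
    using dep by (intro strictly_preserved_skeleton[OF lin that]) blast
  ultimately show ?thesis
    using lin by (auto simp: good_projection_def)
qed

text \<open>This is the argument for neighbourliness of cyclic polytopes: \<open>v\<close>
  annihilates the values of every polynomial of degree at most \<open>d\<close>, so none of these
  can be nonnegative off the negative support, zero on it, and nonzero at a positive entry.\<close>

lemma moment_curve_dependency:
  fixes t :: "'n::finite \<Rightarrow> real" and v :: "real^'n"
  assumes t: "inj t" and v: "v \<noteq> 0" and sum0: "(\<Sum>j\<in>UNIV. v $ j) = 0"
    and mom: "\<And>m. m < d \<Longrightarrow> (\<chi> j. t j ^ Suc m) \<bullet> v = 0"
  shows "d < 2 * card (negs v)"
proof (rule ccontr)
  assume "\<not> ?thesis"
  txt \<open>A polynomial that is nonnegative on the curve and vanishes exactly at the negative entries.\<close>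
  define q where "q = (\<Prod>l\<in>negs v. [:- t l, 1:] ^ 2)"
  have "degree q = 2 * card (negs v)"
    by (simp add: q_def degree_prod_eq_sum_degree degree_power_eq)
  with \<open>\<not> ?thesis\<close> have deg: "degree q \<le> d" by simp
  \<comment> \<open>The functionals supply the exponents from 1 to \<open>d\<close>; exponent 0 is
    the zero-sum condition.\<close>
  have pow0: "(\<Sum>j\<in>UNIV. t j ^ m * v $ j) = 0" if "m \<le> d" for m
    using that sum0 mom[of "m - 1"] by (cases m) (auto simp: inner_vec_def)
  have q: "poly q (t j) = (\<Prod>l\<in>negs v. (t j - t l)\<^sup>2)" for j
    by (simp add: q_def poly_prod)
  have "(\<Sum>j\<in>UNIV. poly q (t j) * v $ j) = (\<Sum>j\<in>UNIV. \<Sum>m\<le>degree q. coeff q m * (t j ^ m * v $ j))"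
    by (simp add: poly_altdef sum_distrib_right mult.assoc)
  also have "\<dots> = (\<Sum>m\<le>degree q. coeff q m * (\<Sum>j\<in>UNIV. t j ^ m * v $ j))"
    by (subst sum.swap) (simp add: sum_distrib_left)
  also have "\<dots> = 0"
    using pow0 deg by simp
  finally have zero: "(\<Sum>j\<in>UNIV. poly q (t j) * v $ j) = 0" .
  have "0 \<le> poly q (t j) * v $ j" for j
  proof (cases "j \<in> negs v")
    case True
    then have "poly q (t j) = 0" by (auto simp: q)
    then show ?thesis by simp
  next
    case False
    then show ?thesis by (auto simp: q negs_def not_less intro!: mult_nonneg_nonneg prod_nonneg)
  qed
  with zero have all0: "poly q (t j) * v $ j = 0" for j
    by (simp add: sum_nonneg_eq_0_iff)
  obtain j where j: "0 < v $ j"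
    using negs_nonempty[of "- v"] sum0 v by (auto simp: negs_uminus sum_negf)
  then have "t j \<noteq> t l" if "l \<in> negs v" for l
    using t that by (auto simp: negs_def inj_eq)
  then have "poly q (t j) \<noteq> 0" by (auto simp: q)
  with all0[of j] j show False by simp
qed

lemma enumeration:
  obtains g :: "nat \<Rightarrow> 'n::finite" where "bij_betw g {..<CARD('n)} UNIV"
  using ex_bij_betw_nat_finite[of "UNIV :: 'n set"] by (auto simp: atLeast0LessThan)

text \<open>Applied to \<open>v\<close> and \<open>- v\<close>, the moment curve gives both supports
  more than \<open>m + i\<close> elements; whichever of \<open>k\<close> and
  \<open>CARD('n) - k\<close> equals \<open>m\<close> decides which alternative holds.\<close>

lemma good_projection_moment_curve:
  assumes k: "1 \<le> k" "k < CARD('n::finite)" and m: "m = min k (CARD('n) - k)"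
  shows "\<exists>\<pi> :: real^'n \<Rightarrow> (nat \<Rightarrow>\<^sub>0 real). good_projection k i (2 * m + 2 * i) \<pi>"
proof -
  obtain g :: "nat \<Rightarrow> 'n" where g: "bij_betw g {..<CARD('n)} UNIV"
    by (rule enumeration)
  define t :: "'n \<Rightarrow> real" where "t j = real (inv_into {..<CARD('n)} g j)" for j
  have t: "inj t"
    using bij_betw_inv_into[OF g] by (auto simp: t_def inj_def bij_betw_def)
  show ?thesis
  proof (rule good_projectionI)
    fix v :: "real^'n"
    assume v: "v \<noteq> 0" "(\<Sum>j\<in>UNIV. v $ j) = 0"
      "\<And>l. l < 2 * m + 2 * i \<Longrightarrow> (\<chi> j. t j ^ Suc l) \<bullet> v = 0"
    have "2 * m + 2 * i < 2 * card (negs v)"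
      by (rule moment_curve_dependency[OF t v])
    moreover have "2 * m + 2 * i < 2 * card (negs (- v))"
      by (rule moment_curve_dependency[OF t]) (use v in \<open>auto simp: sum_negf\<close>)
    ultimately show "2 \<le> card (negs v) \<and> (k + i < card (negs v) \<or> CARD('n) + i < card (negs (- v)) + k)"
      using k unfolding m by (auto simp: min_def split: if_splits)
  qed
qed

text \<open>Forgetting one coordinate is injective on zero-sum vectors, so no nonzero dependency
  remains.\<close>

lemma good_projection_simplex:
  "\<exists>\<pi> :: real^'n \<Rightarrow> (nat \<Rightarrow>\<^sub>0 real). good_projection k i (CARD('n) - 1) \<pi>"
proof -
  obtain g :: "nat \<Rightarrow> 'n" where g: "bij_betw g {..<CARD('n)} UNIV"
    by (rule enumeration)
  show ?thesis
  proof (rule good_projectionI)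
    fix v :: "real^'n"
    assume v: "v \<noteq> 0" "(\<Sum>j\<in>UNIV. v $ j) = 0" "\<And>m. m < CARD('n) - 1 \<Longrightarrow> axis (g m) 1 \<bullet> v = 0"
    have zero: "v $ g m = 0" if "m < CARD('n) - 1" for m
      using v(3)[OF that] by (simp add: inner_axis')
    have "(\<Sum>j\<in>UNIV. v $ j) = (\<Sum>m<CARD('n). v $ g m)"
      by (rule sum.reindex_bij_betw[OF g, symmetric])
    also have "{..<CARD('n)} = insert (CARD('n) - 1) {..<CARD('n) - 1}"
      by (auto simp: less_Suc_eq dest: Suc_lessI)
    also have "(\<Sum>m\<in>\<dots>. v $ g m) = v $ g (CARD('n) - 1)"
      using zero by simp
    finally have "v $ g m = 0" if "m < CARD('n)" for m
      using v(2) zero that by (cases "m = CARD('n) - 1") auto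
    moreover have "\<exists>m<CARD('n). j = g m" for j
      using g by (auto simp: bij_betw_def image_iff)
    ultimately have "v = 0" by (metis vec_eq_iff zero_index)
    with v show "2 \<le> card (negs v) \<and> (k + i < card (negs v) \<or> CARD('n) + i < card (negs (- v)) + k)"
      by simp
  qed
qed

text \<open>The functionals force \<open>v\<close> to be constant on two coordinates and constant on
  the other \<open>CARD('n) - 2\<close>; with zero sum this leaves the multiples of one
  vector.\<close>

lemma good_projection_circuit:
  assumes k: "i + 3 \<le> k" "k + i + 3 \<le> CARD('n::finite)"
  shows "\<exists>\<pi> :: real^'n \<Rightarrow> (nat \<Rightarrow>\<^sub>0 real). good_projection k i (CARD('n) - 2) \<pi>"
proof -
  let ?n = "CARD('n)"
  obtain g :: "nat \<Rightarrow> 'n" where g: "bij_betw g {..<?n} UNIV"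
    by (rule enumeration)
  define c :: "nat \<Rightarrow> real^'n" where "c m = (if m = 0 then axis (g 0) 1 - axis (g 1) 1
    else axis (g (m + 1)) 1 - axis (g (m + 2)) 1)" for m
  show ?thesis
  proof (rule good_projectionI[of _ c])
    fix v :: "real^'n"
    assume v: "v \<noteq> 0" "(\<Sum>j\<in>UNIV. v $ j) = 0" "\<And>m. m < ?n - 2 \<Longrightarrow> c m \<bullet> v = 0"
    define a b where "a = v $ g 0" and "b = v $ g 2"
    have b: "v $ g (m + 2) = b" if "m + 2 < ?n" for m
      using that
    proof (induction m)
      case (Suc m)
      then show ?case using v(3)[of "Suc m"] by (simp add: c_def inner_diff_left inner_axis')
    qed (simp add: b_def numeral_2_eq_2)
    have a: "v $ g 1 = a"
      using v(3)[of 0] k by (simp add: c_def inner_diff_left inner_axis' a_def)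
    have vg: "v $ g m = (if m < 2 then a else b)" if "m < ?n" for m
    proof (cases "m < 2")
      case True
      then have "m = 0 \<or> m = 1" by auto
      with True a show ?thesis by (auto simp: a_def)
    next
      case False
      then obtain l where "m = l + 2" by (metis add.commute le_Suc_ex not_less)
      with b[of l] that show ?thesis by simp
    qed
    have split: "{..<?n} = {..<2} \<union> {2..<?n}" using k by auto
    have "(\<Sum>j\<in>UNIV. v $ j) = (\<Sum>m<?n. v $ g m)"
      by (rule sum.reindex_bij_betw[OF g, symmetric])
    also have "\<dots> = (\<Sum>m<?n. if m < 2 then a else b)"
      using vg by simp
    also have "\<dots> = 2 * a + real (?n - 2) * b"
      unfolding split by (subst sum.union_disjoint) auto
    finally have ab: "2 * a + real (?n - 2) * b = 0"
      using v(2) by simp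
    have card: "card {j. P (v $ j)} = card {m \<in> {..<?n}. P (if m < 2 then a else b)}" for P
    proof -
      have "{j. P (v $ j)} = g ` {m \<in> {..<?n}. P (v $ g m)}"
        using g by (auto simp: bij_betw_def image_iff)
      then have "card {j. P (v $ j)} = card {m \<in> {..<?n}. P (v $ g m)}"
        using g by (auto simp: bij_betw_def intro!: card_image inj_on_subset[of g "{..<?n}"])
      also have "{m \<in> {..<?n}. P (v $ g m)} = {m \<in> {..<?n}. P (if m < 2 then a else b)}"
        using vg by auto
      finally show ?thesis .
    qed
    have n2: "real (?n - 2) > 0" using k by simp
    \<comment> \<open>For \<open>b < 0\<close> the negative support is large enough by
      \<open>k + i + 3 \<le> CARD('n)\<close>, for \<open>b > 0\<close> the positive one by
      \<open>i + 3 \<le> k\<close>.\<close>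
    consider "b = 0" | "b < 0" | "b > 0" by linarith
    then show "2 \<le> card (negs v) \<and> (k + i < card (negs v) \<or> ?n + i < card (negs (- v)) + k)"
    proof cases
      case 1
      with ab have "a = 0" by simp
      have "v $ j = 0" for j
      proof -
        obtain m where "m < ?n" "j = g m"
          using g by (metis UNIV_I bij_betw_def imageE lessThan_iff)
        with vg 1 \<open>a = 0\<close> show ?thesis by simp
      qed
      then have "v = 0" by (simp add: vec_eq_iff)
      with v show ?thesis by simp
    next
      case 2
      then have "real (?n - 2) * b < 0" using n2 by (simp add: mult_pos_neg)
      with ab have "a > 0" by linarith
      then have "{m \<in> {..<?n}. (if m < 2 then a else b) < 0} = {2..<?n}"
        using 2 by auto
      then have "card (negs v) = ?n - 2"
        unfolding negs_def using card[of "\<lambda>x. x < 0"] by simp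
      then show ?thesis using k by linarith
    next
      case 3
      then have "real (?n - 2) * b > 0" using n2 by simp
      with ab have "a < 0" by linarith
      then have "{m \<in> {..<?n}. (if m < 2 then a else b) < 0} = {..<2}"
          "{m \<in> {..<?n}. 0 < (if m < 2 then a else b)} = {2..<?n}"
        using 3 k by auto
      then have "card (negs v) = 2" "card (negs (- v)) = ?n - 2"
        unfolding negs_uminus unfolding negs_def
        using card[of "\<lambda>x. x < 0"] card[of "\<lambda>x. 0 < x"] by simp_all
      then show ?thesis using k by linarith
    qed
  qed
qed

section \<open>The formula for the minimal dimension\<close>

theorem corollary4p1:
  fixes n k i :: nat
  assumes "CARD('n::finite) = n"
    and "1 \<le> k" and "k \<le> n - 1"
    and "i \<le> n - 1"
  shows
    "(int n \<ge> 2 * int k + 2 * int i + 2 \<longrightarrow>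
        int (min_proj_dim TYPE('n) k i) = 2 * int k + 2 * int i) \<and>
     (int n \<le> 2 * int k - 2 * int i - 2 \<longrightarrow>
        int (min_proj_dim TYPE('n) k i) = 2 * int n - 2 * int k + 2 * int i) \<and>
     (2 * int k - 2 * int i - 1 \<le> int n \<and> int n \<le> 2 * int k + 2 * int i + 1 \<and>
        int k \<in> C_set (int n) (int i) \<longrightarrow>
        int (min_proj_dim TYPE('n) k i) = int n - 1) \<and>
     (2 * int k - 2 * int i - 1 \<le> int n \<and> int n \<le> 2 * int k + 2 * int i + 1 \<and>
        int k \<notin> C_set (int n) (int i) \<longrightarrow>
        int (min_proj_dim TYPE('n) k i) = int n - 2)"
proof -
  note n = assms(1)
  have k: "1 \<le> k" "k < CARD('n)" and kn: "k < n"
    using assms by auto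
  define m where "m = min k (n - k)"
  have m: "m = min k (CARD('n) - k)" by (simp add: m_def n)
  \<comment> \<open>Minimality only has to be checked against the two necessary conditions on
    \<open>d\<close>, which involve \<open>k\<close> through \<open>m\<close> alone.\<close>
  have eqI: "min_proj_dim TYPE('n) k i = D"
    if "\<exists>\<pi> :: real^'n \<Rightarrow> (nat \<Rightarrow>\<^sub>0 real). good_projection k i D \<pi>"
      and "\<And>d. n \<le> d + 2 \<or> 2 * m + 2 * i \<le> d \<Longrightarrow>
        n \<le> d + 1 \<or> 2 * m + 2 * i + 2 \<le> n \<or> i + 3 \<le> m \<Longrightarrow> D \<le> d" for D
    unfolding min_proj_dim_def
  proof (rule Least_equality)
    fix d assume "\<exists>\<pi> :: real^'n \<Rightarrow> (nat \<Rightarrow>\<^sub>0 real). good_projection k i d \<pi>"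
    then show "D \<le> d"
      using good_projection_dims[OF _ k m] n by (intro that(2)) blast+
  qed (rule that(1))
  have neighbourly: "min_proj_dim TYPE('n) k i = 2 * m + 2 * i" if "2 * m + 2 * i + 2 \<le> n"
    by (rule eqI[OF good_projection_moment_curve[OF k m]]) (use that in linarith)
  have simplex: "min_proj_dim TYPE('n) k i = n - 1" if "n < 2 * m + 2 * i + 2" "m < i + 3"
    by (rule eqI) (use that good_projection_simplex n in \<open>auto\<close>)
  have circuit: "min_proj_dim TYPE('n) k i = n - 2" if "n < 2 * m + 2 * i + 2" "i + 3 \<le> m"
    by (rule eqI) (use that good_projection_circuit[of i k, where 'n = 'n] n kn in \<open>auto simp: m_def\<close>)
  \<comment> \<open>Membership means that \<open>k\<close> or \<open>n - k\<close> is at most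
    \<open>i + 2\<close>.\<close>
  have C: "int k \<in> C_set (int n) (int i) \<longleftrightarrow> m < i + 3"
    using k kn by (auto simp: C_set_def m_def)
  show ?thesis
  \<comment> \<open>The first two cases of the formula are \<open>2 * m + 2 * i + 2 \<le> n\<close>
    for \<open>m = k\<close> and for \<open>m = n - k\<close>.\<close>
  proof (cases "2 * k \<le> n")
    case True
    then have "m = k" by (simp add: m_def)
    with True show ?thesis
      unfolding C using neighbourly simplex circuit kn
      by (cases "2 * m + 2 * i + 2 \<le> n"; cases "m < i + 3") auto
  next
    case False
    then have "m = n - k" by (simp add: m_def)
    with False show ?thesis
      unfolding C using neighbourly simplex circuit kn
      by (cases "2 * m + 2 * i + 2 \<le> n"; cases "m < i + 3") auto
  qed
qed

end
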